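(* Let $t\in\mathbb{R}\setminus\{0\}$, and let $f\in\mathcal{F}_{t,U}$ for a connected $U\in\mathcal{T}_t$ in $\mathbb{H}_t$. If $f$ is left $t$-regular on $U$, then $f$ is $t$-harmonic on $U$.
   Context: For $t\in\mathbb{R}$, $\mathbb{H}_t$ (the $t$-scaled hypercomplexes) is the associative unital real algebra with $\mathbb{R}$-basis $\{1,i,j_t,k_t\}$ and multiplication determined by $i^2=-1$, $j_t^2=k_t^2=t$, $ij_t=k_t$, $j_tk_t=-ti$, $k_ti=j_t$, $j_ti=-k_t$, $ik_t=-j_t$, $k_tj_t=ti$. Its elements are written $w=x_1+x_2i+x_3j_t+x_4k_t$ with $x_1,x_2,x_3,x_4\in\mathbb{R}$. $\mathcal{T}_t$ is the topology on $\mathbb{H}_t$ induced by the semi-norm $\|w\|_t=\sqrt{|x_1^2+x_2^2-t(x_3^2+x_4^2)|}$. $\mathcal{F}_{t,U}$ is the set of functions $f:\mathbb{H}_t\to\mathbb{H}_t$ that are $\mathbb{R}$-differentiable on $U$ ($U$ being regarded as an open subset of $\mathbb{R}^4$). For $t\neq0$, $\mathrm{sgn}(t)=1$ if $t>0$ and $-1$ if $t<0$. A function $f\in\mathcal{F}_{t,U}$ is left $t$-regular on $U$ if $$\nabla_t f=\frac{\partial f}{\partial x_1}+i\frac{\partial f}{\partial x_2}-j_t\frac{\mathrm{sgn}(t)\,\partial f}{\sqrt{|t|}\,\partial x_3}-k_t\frac{\mathrm{sgn}(t)\,\partial f}{\sqrt{|t|}\,\partial x_4}=0$$ on $U$, and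 $t$-harmonic on $U$ if $$\varDelta_t f=\frac{\partial^2 f}{\partial x_1^2}+\frac{\partial^2 f}{\partial x_2^2}-\frac{\mathrm{sgn}(t)\,\partial^2 f}{\partial x_3^2}-\frac{\mathrm{sgn}(t)\,\partial^2 f}{\partial x_4^2}=0$$ on $U$.
   Formalization: "R-differentiable on U" is read as twice differentiable (f and its first partial derivatives are differentiable on U); with once differentiable functions the second partials in the t-Laplacian need not exist, e.g. t=1, f=φ(x1+x3)(1+j), φ(s)=s|s|. *)

theory Defs
  imports "HOL-Analysis.Analysis"
begin

text \<open>
  The underlying real vector space of the algebra \<open>H\<^sub>t\<close> is the same for all \<open>t\<close>, so \<open>H\<^sub>t\<close> is
  represented as \<^typ>\<open>real ^ 4\<close>, with coordinates with respect to \<open>1, i, j\<^sub>t, k\<^sub>t\<close>; only the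
  multiplication depends on \<open>t\<close>.  In the index type \<open>4\<close> the last index \<open>4\<close> equals \<open>0\<close>.
\<close>

type_synonym hyp = "real ^ 4"

definition hmult :: "real \<Rightarrow> hyp \<Rightarrow> hyp \<Rightarrow> hyp" where
  "hmult t x y = vector
    [x$1 * y$1 - x$2 * y$2 + t * (x$3 * y$3) + t * (x$4 * y$4),
     x$1 * y$2 + x$2 * y$1 - t * (x$3 * y$4) + t * (x$4 * y$3),
     x$1 * y$3 + x$3 * y$1 - x$2 * y$4 + x$4 * y$2,
     x$1 * y$4 + x$4 * y$1 + x$2 * y$3 - x$3 * y$2]"

definition hone :: hyp where "hone = axis 1 1"
definition hi :: hyp where "hi = axis 2 1"
definition hj :: hyp where "hj = axis 3 1"
definition hk :: hyp where "hk = axis 4 1"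

lemma hyp_eq_iff: "x = y \<longleftrightarrow> x$1 = y$1 \<and> x$2 = y$2 \<and> x$3 = y$3 \<and> x$4 = y$4"
  for x y :: hyp
  by (simp add: vec_eq_iff forall_4)

lemma hmult_nth [simp]:
  "hmult t x y $ 1 = x$1 * y$1 - x$2 * y$2 + t * (x$3 * y$3) + t * (x$4 * y$4)"
  "hmult t x y $ 2 = x$1 * y$2 + x$2 * y$1 - t * (x$3 * y$4) + t * (x$4 * y$3)"
  "hmult t x y $ 3 = x$1 * y$3 + x$3 * y$1 - x$2 * y$4 + x$4 * y$2"
  "hmult t x y $ 4 = x$1 * y$4 + x$4 * y$1 + x$2 * y$3 - x$3 * y$2"
  by (simp_all add: hmult_def vector_def)

lemma hmult_table:
  "hmult t hi hi = - hone"
  "hmult t hj hj = t *\<^sub>R hone"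
  "hmult t hk hk = t *\<^sub>R hone"
  "hmult t hi hj = hk"
  "hmult t hj hk = - (t *\<^sub>R hi)"
  "hmult t hk hi = hj"
  "hmult t hj hi = - hk"
  "hmult t hi hk = - hj"
  "hmult t hk hj = t *\<^sub>R hi"
  by (simp_all add: hyp_eq_iff hone_def hi_def hj_def hk_def axis_def)

lemma hmult_one: "hmult t hone x = x" "hmult t x hone = x"
  by (simp_all add: hyp_eq_iff hone_def axis_def)

lemma hmult_assoc: "hmult t (hmult t x y) z = hmult t x (hmult t y z)"
  by (simp add: hyp_eq_iff algebra_simps)

lemma bilinear_hmult: "bilinear (hmult t)"
  by (simp add: bilinear_def linear_iff hyp_eq_iff algebra_simps)

lemma hyp_expand: "w = (w$1) *\<^sub>R hone + (w$2) *\<^sub>R hi + (w$3) *\<^sub>R hj + (w$4) *\<^sub>R hk"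
  by (simp add: hyp_eq_iff hone_def hi_def hj_def hk_def axis_def)

definition hnorm :: "real \<Rightarrow> hyp \<Rightarrow> real" where
  "hnorm t w = sqrt \<bar>(w$1)\<^sup>2 + (w$2)\<^sup>2 - t * ((w$3)\<^sup>2 + (w$4)\<^sup>2)\<bar>"

text \<open>
  For \<open>t > 0\<close> the function \<^term>\<open>hnorm t\<close> violates the triangle inequality, so its balls are only a
  subbase of a topology, not a base.  (Requiring instead that an open set contain, with each point,
  a ball centred there would leave only the empty set and the whole space when \<open>t > 0\<close>, since such
  a ball contains the whole cone \<open>hnorm t (w - a) = 0\<close>.)
\<close>

definition htop :: "real \<Rightarrow> hyp topology" where
  "htop t = topology_generated_by {{w. hnorm t (w - a) < r} | a r. 0 < r}"

definition partial :: "4 \<Rightarrow> (hyp \<Rightarrow> hyp) \<Rightarrow> hyp \<Rightarrow> hyp" where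
  "partial n f x = vector_derivative (\<lambda>s. f (x + s *\<^sub>R axis n 1)) (at 0)"

text \<open>
  Real differentiability is understood to the order that the operators below require of the
  members of \<open>F\<^sub>t\<^sub>,\<^sub>U\<close>: a function in \<open>F\<^sub>t\<^sub>,\<^sub>U\<close> is twice Frechet differentiable on \<open>U\<close>, so that the
  second partial derivatives in the \<open>t\<close>-Laplacian exist.  Differentiability of first order is not
  enough: for \<open>t > 0\<close> and \<open>\<phi> : \<real> \<rightarrow> \<real>\<close> of class \<open>C\<^sup>1\<close> but not twice differentiable, the function
  \<open>\<phi>(x\<^sub>1 + x\<^sub>3) (1 + j\<^sub>t / sqrt t)\<close> is annihilated by the operator \<open>nabla\<close> below, but its second
  partial derivatives do not all exist.
\<close>

definition hfuns :: "real \<Rightarrow> hyp set \<Rightarrow> (hyp \<Rightarrow> hyp) set" where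
  "hfuns t U = {f. f differentiable_on U \<and> (\<forall>n. partial n f differentiable_on U)}"

definition nabla :: "real \<Rightarrow> (hyp \<Rightarrow> hyp) \<Rightarrow> hyp \<Rightarrow> hyp" where
  "nabla t f x =
     partial 1 f x + hmult t hi (partial 2 f x)
     - hmult t hj ((sgn t / sqrt \<bar>t\<bar>) *\<^sub>R partial 3 f x)
     - hmult t hk ((sgn t / sqrt \<bar>t\<bar>) *\<^sub>R partial 4 f x)"

definition hlaplace :: "real \<Rightarrow> (hyp \<Rightarrow> hyp) \<Rightarrow> hyp \<Rightarrow> hyp" where
  "hlaplace t f x =
     partial 1 (partial 1 f) x + partial 2 (partial 2 f) x
     - sgn t *\<^sub>R partial 3 (partial 3 f) x - sgn t *\<^sub>R partial 4 (partial 4 f) x"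

definition left_regular_on :: "real \<Rightarrow> (hyp \<Rightarrow> hyp) \<Rightarrow> hyp set \<Rightarrow> bool" where
  "left_regular_on t f U \<longleftrightarrow> f \<in> hfuns t U \<and> (\<forall>x\<in>U. nabla t f x = 0)"

definition harmonic_on :: "real \<Rightarrow> (hyp \<Rightarrow> hyp) \<Rightarrow> hyp set \<Rightarrow> bool" where
  "harmonic_on t f U \<longleftrightarrow> f \<in> hfuns t U \<and> (\<forall>x\<in>U. hlaplace t f x = 0)"

end

theory Submission imports Defs begin

text \<open>
  The conjugate operator \<open>\<partial>\<^sub>1 - i \<partial>\<^sub>2 + j\<^sub>t c \<partial>\<^sub>3 + k\<^sub>t c \<partial>\<^sub>4\<close> with \<open>c = sgn t / sqrt \<bar>t\<bar>\<close>
  composed with \<^const>\<open>nabla\<close> is \<^const>\<open>hlaplace\<close>: the diagonal terms match because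
  \<open>c\<^sup>2 t = sgn t\<close>, and the mixed terms cancel because the units anticommute and second partial
  derivatives commute.  The latter needs only that the first partial derivatives be Frechet
  differentiable at the point: the second difference
  \<open>f (x + h u + h v) - f (x + h u) - f (x + h v) + f x\<close>, which is symmetric in \<open>u\<close> and \<open>v\<close>, is
  \<open>h\<^sup>2\<close> times either mixed derivative, up to \<open>o(h\<^sup>2)\<close>.
\<close>

text \<open>The mean value theorem along \<open>u\<close>, applied to the difference of
  \<open>f\<close> on the lines through \<open>x + h v\<close> and \<open>x\<close>, leaves
  \<open>h\<close> times an increment of \<open>p\<close> in direction \<open>v\<close>. Both values
  of \<open>p\<close> are then compared with the linearization of \<open>p\<close> at
  \<open>x\<close>.\<close>

lemma second_difference_estimate:
  fixes f p :: "'a::real_normed_vector \<Rightarrow> real"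
  assumes "open U" "x \<in> U"
    and fu: "\<And>y. y \<in> U \<Longrightarrow> ((\<lambda>s. f (y + s *\<^sub>R u)) has_real_derivative p y) (at 0)"
    and p: "(p has_derivative P) (at x)"
    and "e > 0"
  obtains d where "d > 0"
    "\<And>h. 0 < h \<Longrightarrow> h < d \<Longrightarrow>
      \<bar>f (x + h *\<^sub>R u + h *\<^sub>R v) - f (x + h *\<^sub>R u) - f (x + h *\<^sub>R v) + f x - h\<^sup>2 * P v\<bar> \<le> e * h\<^sup>2"
proof -
  \<comment> \<open>The two linearization errors occur at displacements of norm at most
    \<open>h * (norm u + norm v)\<close> and \<open>h * norm u\<close>; together these are at most
    \<open>h * K\<close>. The summand 1 keeps \<open>K\<close> positive when
    \<open>u = v = 0\<close>.\<close>
  define K where "K = 2 * norm u + norm v + 1"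
  have K: "K > 0" unfolding K_def by (smt (verit) norm_ge_zero)
  interpret P: bounded_linear P using p by (rule has_derivative_bounded_linear)
  from \<open>e > 0\<close> K have "e / K > 0" by simp
  with p obtain d0 where d0: "d0 > 0"
    and pd: "\<And>y. norm (y - x) < d0 \<Longrightarrow> norm (p y - p x - P (y - x)) \<le> e / K * norm (y - x)"
    unfolding has_derivative_at_alt by blast
  obtain r where r: "r > 0" "ball x r \<subseteq> U"
    using \<open>open U\<close> \<open>x \<in> U\<close> open_contains_ball by blast
  \<comment> \<open>For \<open>h < d\<close> the whole parallelogram spanned by \<open>h u\<close>
    and \<open>h v\<close> at \<open>x\<close> lies in \<open>U\<close> and in the region where the
    linearization of \<open>p\<close> is accurate.\<close>
  define d where "d = min r d0 / K"
  have "d > 0" using r d0 K by (simp add: d_def)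
  moreover have "\<bar>f (x + h *\<^sub>R u + h *\<^sub>R v) - f (x + h *\<^sub>R u) - f (x + h *\<^sub>R v) + f x - h\<^sup>2 * P v\<bar>
      \<le> e * h\<^sup>2" if h: "0 < h" "h < d" for h
  proof -
    have hK: "h * K < min r d0"
      using h K by (simp add: d_def pos_less_divide_eq)
    have near: "norm (s *\<^sub>R u + a *\<^sub>R v) \<le> h * (norm u + norm v)"
      if "0 \<le> s" "s \<le> h" "0 \<le> a" "a \<le> h" for s a
    proof -
      have "norm (s *\<^sub>R u + a *\<^sub>R v) \<le> s * norm u + a * norm v"
        using norm_triangle_ineq[of "s *\<^sub>R u" "a *\<^sub>R v"] that by simp
      also have "\<dots> \<le> h * norm u + h * norm v"
        using that by (intro add_mono mult_right_mono) auto
      finally show ?thesis by (simp add: algebra_simps)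
    qed
    have "h * (norm u + norm v) \<le> h * K"
      using h by (intro mult_left_mono) (auto simp: K_def)
    with near hK have near': "norm (s *\<^sub>R u + a *\<^sub>R v) < min r d0"
      if "0 \<le> s" "s \<le> h" "0 \<le> a" "a \<le> h" for s a
      using that by (meson le_less_trans order_trans)
    have inU: "x + s *\<^sub>R u + a *\<^sub>R v \<in> U" if "0 \<le> s" "s \<le> h" "0 \<le> a" "a \<le> h" for s a
    proof -
      have "dist x (x + s *\<^sub>R u + a *\<^sub>R v) = norm (s *\<^sub>R u + a *\<^sub>R v)"
        by (metis add.assoc add_diff_cancel_left' dist_commute dist_norm)
      with near'[OF that] r show ?thesis by auto
    qed
    have der: "((\<lambda>s. f (x + s *\<^sub>R u + a *\<^sub>R v)) has_real_derivative p (x + s *\<^sub>R u + a *\<^sub>R v)) (at s)"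
      if "0 \<le> s" "s \<le> h" "0 \<le> a" "a \<le> h" for s a
    proof -
      have "((\<lambda>z. f (x + (s + z) *\<^sub>R u + a *\<^sub>R v)) has_real_derivative
          p (x + s *\<^sub>R u + a *\<^sub>R v)) (at 0)"
        using fu[OF inU[OF that]] by (simp add: algebra_simps)
      then show ?thesis
        using DERIV_shift[of "\<lambda>s. f (x + s *\<^sub>R u + a *\<^sub>R v)" "p (x + s *\<^sub>R u + a *\<^sub>R v)" 0 s]
        by (simp add: add.commute)
    qed
    \<comment> \<open>The terms with factor 0 stay so that both summands are instances of
      \<open>der\<close>, with \<open>a = h\<close> and \<open>a = 0\<close>.\<close>
    have "\<exists>z>0. z < h \<and>
        (f (x + h *\<^sub>R u + h *\<^sub>R v) - f (x + h *\<^sub>R u + 0 *\<^sub>R v))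
        - (f (x + 0 *\<^sub>R u + h *\<^sub>R v) - f (x + 0 *\<^sub>R u + 0 *\<^sub>R v))
        = (h - 0) * (p (x + z *\<^sub>R u + h *\<^sub>R v) - p (x + z *\<^sub>R u + 0 *\<^sub>R v))"
      using h by (intro MVT2 DERIV_diff der) auto
    then obtain z where z: "0 < z" "z < h" and
      eq: "f (x + h *\<^sub>R u + h *\<^sub>R v) - f (x + h *\<^sub>R u) - f (x + h *\<^sub>R v) + f x
        = h * (p (x + z *\<^sub>R u + h *\<^sub>R v) - p (x + z *\<^sub>R u))"
      by (auto simp: algebra_simps)
    have "\<bar>p (x + z *\<^sub>R u + h *\<^sub>R v) - p x - P (z *\<^sub>R u + h *\<^sub>R v)\<bar> \<le> e / K * norm (z *\<^sub>R u + h *\<^sub>R v)"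
      using pd[of "x + z *\<^sub>R u + h *\<^sub>R v"] near'[of z h] z h by (simp add: add.assoc)
    also have "\<dots> \<le> e / K * (h * (norm u + norm v))"
      using near[of z h] z h \<open>e / K > 0\<close> by (intro mult_left_mono) auto
    finally have 1: "\<bar>p (x + z *\<^sub>R u + h *\<^sub>R v) - p x - P (z *\<^sub>R u + h *\<^sub>R v)\<bar>
        \<le> e / K * (h * (norm u + norm v))" .
    have "\<bar>p (x + z *\<^sub>R u) - p x - P (z *\<^sub>R u)\<bar> \<le> e / K * norm (z *\<^sub>R u)"
      using pd[of "x + z *\<^sub>R u"] near'[of z 0] z h by simp
    also have "\<dots> \<le> e / K * (h * norm u)"
      using z \<open>e / K > 0\<close> by (intro mult_left_mono) (auto intro: mult_right_mono)
    finally have 2: "\<bar>p (x + z *\<^sub>R u) - p x - P (z *\<^sub>R u)\<bar> \<le> e / K * (h * norm u)" .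
    \<comment> \<open>By linearity \<open>P (z u + h v) - P (z u) = h * P v\<close>, so the unknown
      \<open>z\<close> drops out of the main term.\<close>
    have "\<bar>p (x + z *\<^sub>R u + h *\<^sub>R v) - p (x + z *\<^sub>R u) - h * P v\<bar>
        \<le> e / K * (h * (norm u + norm v)) + e / K * (h * norm u)"
      using 1 2 by (simp add: P.add P.scaleR)
    also have "\<dots> = e / K * (h * (2 * norm u + norm v))"
      by (simp add: algebra_simps)
    also have "\<dots> \<le> e / K * (h * K)"
      using \<open>e / K > 0\<close> h by (intro mult_left_mono) (auto simp: K_def)
    also have "\<dots> = e * h" using K by simp
    finally have 3: "\<bar>p (x + z *\<^sub>R u + h *\<^sub>R v) - p (x + z *\<^sub>R u) - h * P v\<bar> \<le> e * h" .
    have "h * (p (x + z *\<^sub>R u + h *\<^sub>R v) - p (x + z *\<^sub>R u)) - h\<^sup>2 * P v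
        = h * (p (x + z *\<^sub>R u + h *\<^sub>R v) - p (x + z *\<^sub>R u) - h * P v)"
      by (simp add: power2_eq_square algebra_simps)
    then have "\<bar>h * (p (x + z *\<^sub>R u + h *\<^sub>R v) - p (x + z *\<^sub>R u)) - h\<^sup>2 * P v\<bar>
        = h * \<bar>p (x + z *\<^sub>R u + h *\<^sub>R v) - p (x + z *\<^sub>R u) - h * P v\<bar>"
      using h by (simp add: abs_mult)
    also have "\<dots> \<le> h * (e * h)"
      using 3 h by (intro mult_left_mono) auto
    finally show ?thesis
      unfolding eq by (simp add: power2_eq_square algebra_simps)
  qed
  ultimately show thesis by (rule that)
qed

text \<open>Both numbers are the limit, as \<open>h\<close> tends to 0 from the right, of one second
  difference divided by \<open>h\<close> squared.\<close>

lemma mixed_derivatives_commute_real: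
  fixes f p q :: "'a::real_normed_vector \<Rightarrow> real"
  assumes U: "open U" "x \<in> U"
    and fu: "\<And>y. y \<in> U \<Longrightarrow> ((\<lambda>s. f (y + s *\<^sub>R u)) has_real_derivative p y) (at 0)"
    and fv: "\<And>y. y \<in> U \<Longrightarrow> ((\<lambda>s. f (y + s *\<^sub>R v)) has_real_derivative q y) (at 0)"
    and p: "(p has_derivative P) (at x)"
    and q: "(q has_derivative Q) (at x)"
  shows "P v = Q u"
proof -
  have "\<bar>P v - Q u\<bar> \<le> 0 + e" if "e > 0" for e
  proof -
    from that have e: "e / 2 > 0" by simp
    obtain d1 where d1: "d1 > 0" "\<And>h. 0 < h \<Longrightarrow> h < d1 \<Longrightarrow>
        \<bar>f (x + h *\<^sub>R u + h *\<^sub>R v) - f (x + h *\<^sub>R u) - f (x + h *\<^sub>R v) + f x - h\<^sup>2 * P v\<bar> \<le> e / 2 * h\<^sup>2"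
      using second_difference_estimate[where f = f and p = p, OF U fu p e] by blast
    obtain d2 where d2: "d2 > 0" "\<And>h. 0 < h \<Longrightarrow> h < d2 \<Longrightarrow>
        \<bar>f (x + h *\<^sub>R v + h *\<^sub>R u) - f (x + h *\<^sub>R v) - f (x + h *\<^sub>R u) + f x - h\<^sup>2 * Q u\<bar> \<le> e / 2 * h\<^sup>2"
      using second_difference_estimate[where f = f and p = q, OF U fv q e] by blast
    define h where "h = min d1 d2 / 2"
    have h: "0 < h" "h < d1" "h < d2" using d1(1) d2(1) by (auto simp: h_def)
    \<comment> \<open>Now both estimates speak of the same four values of \<open>f\<close>; these
      cancel on subtraction and the two errors \<open>e / 2\<close> add up to
      \<open>e\<close>.\<close>
    have "x + h *\<^sub>R v + h *\<^sub>R u = x + h *\<^sub>R u + h *\<^sub>R v" by simp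
    with d1(2)[OF h(1,2)] d2(2)[OF h(1,3)] have "\<bar>h\<^sup>2 * P v - h\<^sup>2 * Q u\<bar> \<le> e * h\<^sup>2"
      by (simp only:)
    also have "\<bar>h\<^sup>2 * P v - h\<^sup>2 * Q u\<bar> = h\<^sup>2 * \<bar>P v - Q u\<bar>"
      by (simp add: abs_mult flip: right_diff_distrib)
    finally show ?thesis using h by (simp add: mult.commute)
  qed
  then have "\<bar>P v - Q u\<bar> \<le> 0" by (rule field_le_epsilon)
  then show ?thesis by simp
qed

text \<open>The mean value theorem is scalar, so the vector case is tested against every
  \<open>b\<close> through the inner product.\<close>

lemma mixed_derivatives_commute:
  fixes f p q :: "'a::real_normed_vector \<Rightarrow> 'b::real_inner"
  assumes U: "open U" "x \<in> U"
    and fu: "\<And>y. y \<in> U \<Longrightarrow> ((\<lambda>s. f (y + s *\<^sub>R u)) has_vector_derivative p y) (at 0)"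
    and fv: "\<And>y. y \<in> U \<Longrightarrow> ((\<lambda>s. f (y + s *\<^sub>R v)) has_vector_derivative q y) (at 0)"
    and p: "(p has_derivative P) (at x)"
    and q: "(q has_derivative Q) (at x)"
  shows "P v = Q u"
proof -
  have component: "((\<lambda>s. g s \<bullet> b) has_real_derivative g' \<bullet> b) (at 0)"
    if "(g has_vector_derivative g') (at 0)" for g :: "real \<Rightarrow> 'b" and g' b
    using bounded_linear.has_vector_derivative[OF bounded_linear_inner_left that]
    by (simp add: has_real_derivative_iff_has_vector_derivative)
  have "P v \<bullet> b = Q u \<bullet> b" for b
    by (rule mixed_derivatives_commute_real[where f = "\<lambda>y. f y \<bullet> b" and p = "\<lambda>y. p y \<bullet> b"
          and q = "\<lambda>y. q y \<bullet> b", OF U])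
      (auto intro: component fu fv bounded_linear.has_derivative[OF bounded_linear_inner_left] p q)
  then show ?thesis by (metis inner_commute vector_eq_rdot)
qed

text \<open>Continuity of \<open>hnorm t\<close> makes every subbasic set Euclidean open, so Frechet
  derivatives can be taken at each point of \<open>U\<close>.\<close>

lemma open_if_openin_htop:
  assumes "openin (htop t) U"
  shows "open U"
proof -
  have ball: "open {w. hnorm t (w - a) < r}" for a r
    unfolding hnorm_def by (intro open_Collect_less continuous_intros)
  have "generate_topology_on {{w. hnorm t (w - a) < r} | a r. 0 < r} U"
    using assms by (simp add: htop_def openin_topology_generated_by_iff)
  then show ?thesis
    by (induction rule: generate_topology_on.induct) (auto intro: ball)
qed

lemma has_vector_derivative_along_line:
  fixes f :: "'a::real_normed_vector \<Rightarrow> 'b::real_normed_vector"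
  assumes "(f has_derivative D) (at x)"
  shows "((\<lambda>s. f (x + s *\<^sub>R v)) has_vector_derivative D v) (at 0)"
proof -
  interpret bounded_linear D using assms by (rule has_derivative_bounded_linear)
  have "((\<lambda>s. x + s *\<^sub>R v) has_derivative (\<lambda>s. s *\<^sub>R v)) (at 0)"
    by (auto intro!: derivative_eq_intros)
  moreover have "(f has_derivative D) (at (x + 0 *\<^sub>R v))" using assms by simp
  ultimately show ?thesis
    unfolding has_vector_derivative_def
    using has_derivative_compose[of "\<lambda>s. x + s *\<^sub>R v" "\<lambda>s. s *\<^sub>R v" 0 UNIV f D]
    by (simp add: scaleR)
qed

text \<open>\<open>partial\<close> is built on the choice term \<open>vector_derivative\<close>; a
  Frechet derivative at the point fixes its value.\<close>

lemma partial_eq_derivative: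
  assumes "(f has_derivative D) (at x)"
  shows "partial n f x = D (axis n 1)"
  unfolding partial_def
  using has_vector_derivative_along_line[OF assms] by (rule vector_derivative_at)

lemma has_vector_derivative_partial:
  assumes "f differentiable at x"
  shows "((\<lambda>s. f (x + s *\<^sub>R axis n 1)) has_vector_derivative partial n f x) (at 0)"
  using assms has_vector_derivative_along_line partial_eq_derivative
  unfolding differentiable_def by metis

lemma partial_partial_commute:
  assumes "open U" "x \<in> U" and f: "\<And>y. y \<in> U \<Longrightarrow> f differentiable at y"
    and "partial m f differentiable at x" "partial n f differentiable at x"
  shows "partial n (partial m f) x = partial m (partial n f) x"
proof -
  obtain P Q where P: "(partial m f has_derivative P) (at x)"
    and Q: "(partial n f has_derivative Q) (at x)"
    using assms(4,5) unfolding differentiable_def by blast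
  have "P (axis n 1) = Q (axis m 1)"
    using assms(1,2) by (rule mixed_derivatives_commute) (auto intro: has_vector_derivative_partial f P Q)
  then show ?thesis
    by (simp add: partial_eq_derivative[OF P] partial_eq_derivative[OF Q])
qed

lemma bounded_linear_hmult_right: "bounded_linear (hmult t a)"
  using bilinear_hmult by (simp add: bilinear_def linear_conv_bounded_linear)

text \<open>Left multiplication by a fixed unit is bounded linear, so differentiation passes through
  it.\<close>

lemma partial_nabla:
  assumes "\<And>m. partial m f differentiable at x"
  shows "partial n (nabla t f) x =
     partial n (partial 1 f) x + hmult t hi (partial n (partial 2 f) x)
     - hmult t hj ((sgn t / sqrt \<bar>t\<bar>) *\<^sub>R partial n (partial 3 f) x)
     - hmult t hk ((sgn t / sqrt \<bar>t\<bar>) *\<^sub>R partial n (partial 4 f) x)"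
proof -
  obtain D where D: "\<And>m. (partial m f has_derivative D m) (at x)"
    using assms unfolding differentiable_def by metis
  have "(nabla t f has_derivative (\<lambda>v. D 1 v + hmult t hi (D 2 v)
      - hmult t hj ((sgn t / sqrt \<bar>t\<bar>) *\<^sub>R D 3 v) - hmult t hk ((sgn t / sqrt \<bar>t\<bar>) *\<^sub>R D 4 v))) (at x)"
    unfolding nabla_def[abs_def]
    by (intro has_derivative_add has_derivative_diff has_derivative_scaleR_right D
        bounded_linear.has_derivative[OF bounded_linear_hmult_right])
  then show ?thesis by (simp add: partial_eq_derivative[OF D] partial_eq_derivative)
qed

lemma conjugate_nabla_eq_hlaplace:
  assumes "t \<noteq> 0" "open U" "x \<in> U" and f: "\<And>y. y \<in> U \<Longrightarrow> f differentiable at y"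
    and pf: "\<And>m. partial m f differentiable at x"
  shows "partial 1 (nabla t f) x - hmult t hi (partial 2 (nabla t f) x)
     + hmult t hj ((sgn t / sqrt \<bar>t\<bar>) *\<^sub>R partial 3 (nabla t f) x)
     + hmult t hk ((sgn t / sqrt \<bar>t\<bar>) *\<^sub>R partial 4 (nabla t f) x) = hlaplace t f x"
proof -
  define c where "c = sgn t / sqrt \<bar>t\<bar>"
  have s: "sgn t = t * c * c"
    using \<open>t \<noteq> 0\<close> by (auto simp: c_def sgn_if field_simps)
  note comm = partial_partial_commute[OF assms(2,3) f pf pf]
  \<comment> \<open>All six pairs are oriented the same way, so that as rewrite rules they bring
    mixed derivatives to a normal form.\<close>
  have commutes:
    "partial 2 (partial 1 f) x = partial 1 (partial 2 f) x"
    "partial 3 (partial 1 f) x = partial 1 (partial 3 f) x"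
    "partial 4 (partial 1 f) x = partial 1 (partial 4 f) x"
    "partial 3 (partial 2 f) x = partial 2 (partial 3 f) x"
    "partial 4 (partial 2 f) x = partial 2 (partial 4 f) x"
    "partial 4 (partial 3 f) x = partial 3 (partial 4 f) x"
    by (auto intro: comm)
  show ?thesis
    \<comment> \<open>Since \<open>c\<close> itself contains \<open>sgn t\<close>, it is folded
      before \<open>s\<close> replaces the remaining \<open>sgn t\<close> of the Laplacian. What is
      left is a polynomial identity in each of the four coordinates.\<close>
    unfolding hlaplace_def partial_nabla[OF pf] commutes c_def[symmetric]
    unfolding s
    by (simp add: hyp_eq_iff hi_def hj_def hk_def axis_def algebra_simps)
qed

theorem theorem36:
  fixes t :: real and U :: "hyp set" and f :: "hyp \<Rightarrow> hyp"
  assumes "t \<noteq> 0"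
    and "openin (htop t) U"
    and "connectedin (htop t) U"
    and "f \<in> hfuns t U"
    and "left_regular_on t f U"
  shows "harmonic_on t f U"
proof -
  have U: "open U" using assms(2) by (rule open_if_openin_htop)
  have f: "f differentiable at y" and pf: "partial m f differentiable at y" if "y \<in> U" for y m
    using assms(4) that by (auto simp: hfuns_def differentiable_on_eq_differentiable_at[OF U])
  have "hlaplace t f x = 0" if x: "x \<in> U" for x
  proof -
    \<comment> \<open>\<open>nabla t f\<close> agrees with the zero function on the open set
      \<open>U\<close> around \<open>x\<close>, hence has zero derivative there.\<close>
    have "((\<lambda>_. 0) has_derivative (\<lambda>_. 0)) (at x)" by simp
    then have "(nabla t f has_derivative (\<lambda>_. 0)) (at x)"
      using U x by (rule has_derivative_transform_within_open)
        (use assms(5) in \<open>auto simp: left_regular_on_def\<close>)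
    then have "partial n (nabla t f) x = 0" for n
      by (rule partial_eq_derivative)
    then show ?thesis
      using conjugate_nabla_eq_hlaplace[OF assms(1) U x f pf[OF x]]
      by (simp add: hyp_eq_iff)
  qed
  with assms(4) show ?thesis by (simp add: harmonic_on_def)
qed

end
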